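(* Let $X$ be a connected weighted non-bipartite graph with vertex $u$. If $0\notin\Phi_{\mathbf e_u}(X)$, then the two copies $(0,u)$ and $(1,u)$ of $u$ in $K_2\times X$ are not sedentary. Additionally, if $A(X)$ is nonsingular, then no vertex of $K_2\times X$ is sedentary.
   Context: Graphs are simple, connected, undirected, with nonzero real edge weights; $A(X)$ is the weighted adjacency matrix, $E_\lambda$ the orthogonal projection onto its $\lambda$-eigenspace, and $\Phi_{\mathbf e_u}(X)=\{\lambda:E_\lambda\mathbf e_u\ne0\}$. The bipartite double $K_2\times X$ has vertex set $\{0,1\}\times V(X)$ and adjacency matrix $A(K_2)\otimes A(X)$. With $U(t)=e^{itA}$, a vertex $u$ is not sedentary if $\inf_{t>0}|U(t)_{u,u}|=0$ and sedentary if this infimum is positive. *)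

theory Defs
  imports "HOL-Analysis.Analysis"
begin

text \<open>Weighted graphs on a finite vertex type 'n, given by their weighted adjacency
  matrix A: symmetric, zero diagonal; u and v are adjacent iff A u v is nonzero
  (so every edge has a nonzero real weight).\<close>

definition weighted_graph :: "real^'n^'n \<Rightarrow> bool" where
  "weighted_graph A \<longleftrightarrow> transpose A = A \<and> (\<forall>x. A $ x $ x = 0)"

definition adj :: "real^'n^'n \<Rightarrow> 'n \<Rightarrow> 'n \<Rightarrow> bool" where
  "adj A x y \<longleftrightarrow> A $ x $ y \<noteq> 0"

definition connected_graph :: "real^'n^'n \<Rightarrow> bool" where
  "connected_graph A \<longleftrightarrow> (\<forall>x y. (adj A)\<^sup>*\<^sup>* x y)"

definition bipartite_graph :: "real^'n^'n \<Rightarrow> bool" where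
  "bipartite_graph A \<longleftrightarrow> (\<exists>S. \<forall>x y. adj A x y \<longrightarrow> (x \<in> S \<longleftrightarrow> y \<notin> S))"

text \<open>Standard basis vector e_u.\<close>
definition basis_vec :: "'n \<Rightarrow> real^'n" where
  "basis_vec u = (\<chi> i. if i = u then 1 else 0)"

text \<open>The lambda-eigenspace of A and the orthogonal projection E_lambda onto it
  (orthogonal projection onto a subspace = nearest point map).\<close>
definition eigenspace :: "real^'n^'n \<Rightarrow> real \<Rightarrow> (real^'n) set" where
  "eigenspace A c = {v. A *v v = c *\<^sub>R v}"

definition eigenproj :: "real^'n^'n \<Rightarrow> real \<Rightarrow> real^'n \<Rightarrow> real^'n" where
  "eigenproj A c x = closest_point (eigenspace A c) x"

text \<open>Eigenvalue support of e_u.\<close>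
definition eigsupp :: "real^'n^'n \<Rightarrow> 'n \<Rightarrow> real set" where
  "eigsupp A u = {c. eigenproj A c (basis_vec u) \<noteq> 0}"

text \<open>Kronecker product and the bipartite double K_2 x X.\<close>
definition kron :: "real^'a^'a \<Rightarrow> real^'b^'b \<Rightarrow> real^('a \<times> 'b)^('a \<times> 'b)" where
  "kron B C = (\<chi> p q. B $ fst p $ fst q * C $ snd p $ snd q)"

definition adjK2 :: "real^bool^bool" where
  "adjK2 = (\<chi> i j. if i \<noteq> j then 1 else 0)"

definition bip_double :: "real^'n^'n \<Rightarrow> real^(bool \<times> 'n)^(bool \<times> 'n)" where
  "bip_double A = kron adjK2 A"

text \<open>Transition matrix U(t) = exp(i t A), via the exponential power series.\<close>
definition transition :: "real^'n^'n \<Rightarrow> real \<Rightarrow> complex^'n^'n" where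
  "transition A t = (\<chi> x y. \<Sum>k. (\<i> * complex_of_real t) ^ k / of_nat (fact k)
                                * complex_of_real ((((**) A) ^^ k) (mat 1) $ x $ y))"

definition sedentary :: "real^'n^'n \<Rightarrow> 'n \<Rightarrow> bool" where
  "sedentary A u \<longleftrightarrow> (INF t\<in>{0<..}. cmod (transition A t $ u $ u)) > 0"

end

theory Submission
  imports Defs
begin

text \<open>
  Expanding e_u in an orthogonal eigenbasis of the symmetric matrix A gives
  (A^k)_{uu} = \<Sum>_\<theta> w_\<theta> \<theta>^k with weights w_\<theta> > 0 only on the eigenvalue support of u.
  The odd powers of the adjacency matrix of K_2 \<times> X vanish on the diagonal, so the return
  amplitude of (b, u) is f(t) = \<Sum>_\<theta> w_\<theta> cos(\<theta> t). If 0 is not in the support, f has a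
  positive zero: otherwise f(t) (1 - cos(c t)) \<ge> 0 on [0, \<infinity>) for c = |\<theta>_0|, while its primitive
  from 0 is bounded by K - T w_{\<theta>_0} / 2, since the product has a non-oscillating part only
  at the frequencies \<theta> = \<plusminus>c.
\<close>

lemma inner_matrix_vector_symmetric:
  fixes A :: "real^'n^'n"
  assumes "transpose A = A"
  shows "inner (A *v x) y = inner x (A *v y)"
  by (metis assms dot_lmul_matrix transpose_matrix_vector)

lemma subspace_eigenspace: "subspace (eigenspace A c)"
  unfolding subspace_def eigenspace_def
  by (auto simp: matrix_vector_right_distrib matrix_vector_mult_scaleR scaleR_right_distrib)

lemma eigenspaces_orthogonal:
  fixes A :: "real^'n^'n"
  assumes "transpose A = A" "x \<in> eigenspace A c" "y \<in> eigenspace A d" "c \<noteq> d"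
  shows "inner x y = 0"
proof -
  have "c * inner x y = inner (A *v x) y"
    using assms(2) by (simp add: eigenspace_def)
  also have "\<dots> = inner x (A *v y)"
    by (rule inner_matrix_vector_symmetric[OF assms(1)])
  also have "\<dots> = d * inner x y"
    using assms(3) by (simp add: eigenspace_def)
  finally show ?thesis
    using assms(4) by simp
qed

lemma quadratic_nonneg_imp_linear_coeff_zero:
  fixes b c :: real
  assumes "\<And>s. 0 \<le> s * b + s\<^sup>2 * c"
  shows "b = 0"
proof -
  define s where "s = - b / (\<bar>c\<bar> + 1)"
  have "0 \<le> s * b + s\<^sup>2 * c"
    by (rule assms)
  also have "\<dots> \<le> s * b + s\<^sup>2 * \<bar>c\<bar>"
    by (simp add: mult_left_mono)
  also have "\<dots> = - b\<^sup>2 / (\<bar>c\<bar> + 1)\<^sup>2"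
    unfolding s_def by (simp add: divide_simps power2_eq_square) (simp add: algebra_simps)
  finally have "b\<^sup>2 / (\<bar>c\<bar> + 1)\<^sup>2 \<le> 0"
    by simp
  moreover have "(\<bar>c\<bar> + 1)\<^sup>2 > 0"
    by (simp add: add_pos_nonneg)
  ultimately show ?thesis
    by (simp add: divide_le_0_iff)
qed

lemma rayleigh_maximizer_is_eigenvector:
  fixes A :: "real^'n^'n"
  assumes sym: "transpose A = A" and W: "subspace W"
    and invariant: "\<And>y. y \<in> W \<Longrightarrow> A *v y \<in> W"
    and x: "x \<in> W" "norm x = 1"
    and max: "\<And>y. y \<in> W \<Longrightarrow> norm y = 1 \<Longrightarrow> inner (A *v y) y \<le> inner (A *v x) x"
  shows "x \<in> eigenspace A (inner (A *v x) x)"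
proof -
  define m where "m = inner (A *v x) x"
  define Q where "Q y = m * inner y y - inner (A *v y) y" for y
  have Q_nonneg: "0 \<le> Q y" if "y \<in> W" for y
  proof (cases "y = 0")
    case False
    have "inner (A *v (y /\<^sub>R norm y)) (y /\<^sub>R norm y) \<le> m"
      unfolding m_def using False that W by (intro max) (auto simp: subspace_scale)
    then have "inner (A *v y) y \<le> m * (norm y)\<^sup>2"
      using False by (simp add: matrix_vector_mult_scaleR power2_eq_square field_simps)
    then show ?thesis
      unfolding Q_def by (simp add: power2_norm_eq_inner)
  qed (simp add: Q_def)
  define r where "r = m *\<^sub>R x - A *v x"
  have "r \<in> W"
    unfolding r_def using W x(1) invariant by (simp add: subspace_diff subspace_scale)
  \<comment> \<open>Q is nonnegative on W and vanishes at x, so its linear term along x + s r must vanish\<close>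
  have "Q (x + s *\<^sub>R r) = s * (2 * inner r r) + s\<^sup>2 * Q r" for s
  proof -
    have "inner x x = 1"
      using x(2) by (simp add: norm_eq_1)
    then have quadratic: "inner (x + s *\<^sub>R r) (x + s *\<^sub>R r) = 1 + 2 * s * inner x r + s\<^sup>2 * inner r r"
      by (simp add: inner_add_left inner_add_right inner_commute power2_eq_square)
    have "inner (A *v r) x = inner r (A *v x)"
      by (rule inner_matrix_vector_symmetric[OF sym])
    then have form: "inner (A *v (x + s *\<^sub>R r)) (x + s *\<^sub>R r)
        = m + 2 * s * inner (A *v x) r + s\<^sup>2 * inner (A *v r) r"
      unfolding m_def
      by (simp add: matrix_vector_right_distrib matrix_vector_mult_scaleR inner_add_left
          inner_add_right inner_commute power2_eq_square distrib_left)
    have residual: "inner r r = m * inner x r - inner (A *v x) r"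
      unfolding r_def by (simp add: inner_diff_left)
    show ?thesis
      unfolding Q_def quadratic form residual by algebra
  qed
  then have "0 \<le> s * (2 * inner r r) + s\<^sup>2 * Q r" for s
    using Q_nonneg W x(1) \<open>r \<in> W\<close> by (metis subspace_add subspace_scale)
  then have "r = 0"
    using quadratic_nonneg_imp_linear_coeff_zero by fastforce
  then show ?thesis
    unfolding r_def m_def eigenspace_def by simp
qed

lemma invariant_subspace_has_eigenvector:
  fixes A :: "real^'n^'n"
  assumes sym: "transpose A = A" and W: "subspace W"
    and invariant: "\<And>y. y \<in> W \<Longrightarrow> A *v y \<in> W"
    and nontrivial: "z \<in> W" "z \<noteq> 0"
  obtains x c where "x \<in> W" "x \<noteq> 0" "x \<in> eigenspace A c"
proof -
  define K where "K = W \<inter> sphere 0 1"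
  have "compact K"
    unfolding K_def using W by (intro closed_Int_compact closed_subspace) auto
  moreover have "z /\<^sub>R norm z \<in> K"
    unfolding K_def using nontrivial W by (auto simp: subspace_scale)
  moreover have "continuous_on K (\<lambda>y. inner (A *v y) y)"
    by (intro continuous_intros)
  ultimately obtain x where "x \<in> K" and "\<And>y. y \<in> K \<Longrightarrow> inner (A *v y) y \<le> inner (A *v x) x"
    using continuous_attains_sup[of K] by blast
  then have "x \<in> W" "norm x = 1" "x \<in> eigenspace A (inner (A *v x) x)"
    unfolding K_def
    by (auto intro!: rayleigh_maximizer_is_eigenvector[OF sym W invariant])
  then show ?thesis
    using that by fastforce
qed

lemma orthogonal_comp_invariant:
  fixes A :: "real^'n^'n"
  assumes "transpose A = A" and "\<And>y. y \<in> U \<Longrightarrow> A *v y \<in> U" and "x \<in> U\<^sup>\<bottom>"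
  shows "A *v x \<in> U\<^sup>\<bottom>"
proof -
  have "inner y (A *v x) = 0" if "y \<in> U" for y
  proof -
    have "inner y (A *v x) = inner (A *v y) x"
      by (simp add: inner_matrix_vector_symmetric[OF assms(1)])
    also have "\<dots> = 0"
      using assms(2)[OF that] assms(3) by (simp add: orthogonal_comp_def orthogonal_def)
    finally show ?thesis .
  qed
  then show ?thesis
    by (simp add: orthogonal_comp_def orthogonal_def)
qed

theorem span_eigenspaces_symmetric:
  fixes A :: "real^'n^'n"
  assumes sym: "transpose A = A"
  shows "span (\<Union>c. eigenspace A c) = UNIV"
proof -
  define U where "U = span (\<Union>c. eigenspace A c)"
  have "A *v y \<in> U" if "y \<in> U" for y
    using that unfolding U_def
  proof (induction rule: span_induct_alt)
    case (step a x y)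
    then obtain c where "A *v x = c *\<^sub>R x"
      by (auto simp: eigenspace_def)
    then have "A *v (a *\<^sub>R x + y) = (a * c) *\<^sub>R x + A *v y"
      by (simp add: matrix_vector_right_distrib matrix_vector_mult_scaleR)
    then show ?case
      using step by (simp add: span_add span_scale span_base)
  qed (simp add: span_zero)
  then have invariant: "A *v y \<in> U\<^sup>\<bottom>" if "y \<in> U\<^sup>\<bottom>" for y
    using orthogonal_comp_invariant[OF sym] that by blast
  have "U\<^sup>\<bottom> = {0}"
  proof (rule ccontr)
    assume "U\<^sup>\<bottom> \<noteq> {0}"
    then obtain z where "z \<in> U\<^sup>\<bottom>" "z \<noteq> 0"
      using subspace_0[OF subspace_orthogonal_comp] by blast
    then obtain x c where "x \<in> U\<^sup>\<bottom>" "x \<noteq> 0" "x \<in> eigenspace A c"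
      using invariant_subspace_has_eigenvector[OF sym subspace_orthogonal_comp invariant] by blast
    moreover have "x \<in> U"
      unfolding U_def using \<open>x \<in> eigenspace A c\<close> by (auto intro: span_base)
    ultimately show False
      using orthogonal_Int_0[of U] U_def by auto
  qed
  then show ?thesis
    using orthogonal_comp_self[of U] U_def by simp
qed

lemma eigenspace_decomposition:
  fixes A :: "real^'n^'n" and e :: "real^'n"
  assumes sym: "transpose A = A"
  obtains L :: "real set" and x :: "real \<Rightarrow> real^'n"
  where "finite L" "\<And>c. c \<in> L \<Longrightarrow> x c \<in> eigenspace A c"
    "\<And>c. c \<in> L \<Longrightarrow> x c \<noteq> 0"
    "e = (\<Sum>c\<in>L. x c)"
proof -
  have "e \<in> span (\<Union>c. eigenspace A c)"
    by (simp add: span_eigenspaces_symmetric[OF sym])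
  then obtain S coeff where S: "finite S" "S \<subseteq> (\<Union>c. eigenspace A c)"
    and e: "e = (\<Sum>v\<in>S. coeff v *\<^sub>R v)"
    unfolding span_explicit mem_Collect_eq by (elim exE conjE) metis
  define eigval where "eigval v = (SOME c. v \<in> eigenspace A c)" for v
  have eigval: "v \<in> eigenspace A (eigval v)" if "v \<in> S" for v
    using that S(2) unfolding eigval_def by (metis UN_E someI subsetD)
  define x where "x c = (\<Sum>v\<in>{v\<in>S. eigval v = c}. coeff v *\<^sub>R v)" for c
  define L where "L = {c \<in> eigval ` S. x c \<noteq> 0}"
  have "finite L"
    unfolding L_def using S(1) by simp
  moreover have "x c \<in> eigenspace A c" for c
    unfolding x_def using eigval
    by (intro subspace_sum[OF subspace_eigenspace] subspace_scale[OF subspace_eigenspace]) auto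
  moreover have "e = (\<Sum>c\<in>L. x c)"
  proof -
    have "e = (\<Sum>c\<in>eigval ` S. x c)"
      unfolding e x_def using sum.image_gen[OF S(1), of "\<lambda>v. coeff v *\<^sub>R v" eigval] by simp
    also have "\<dots> = (\<Sum>c\<in>L. x c)"
      unfolding L_def using S(1) by (intro sum.mono_neutral_right) auto
    finally show ?thesis .
  qed
  ultimately show ?thesis
    using that unfolding L_def by blast
qed

definition matpow :: "'a::semiring_1^'n^'n \<Rightarrow> nat \<Rightarrow> 'a^'n^'n" where
  "matpow A k = (((**) A) ^^ k) (mat 1)"

lemma matpow_0 [simp]: "matpow A 0 = mat 1"
  by (simp add: matpow_def)

lemma matpow_Suc: "matpow A (Suc k) = A ** matpow A k"
  by (simp add: matpow_def)

lemma matpow_eigenvector: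
  fixes A :: "real^'n^'n"
  assumes "v \<in> eigenspace A c"
  shows "matpow A k *v v = c ^ k *\<^sub>R v"
proof (induction k)
  case (Suc k)
  have "matpow A (Suc k) *v v = A *v (c ^ k *\<^sub>R v)"
    by (simp add: matpow_Suc matrix_vector_mul_assoc[symmetric] Suc)
  then show ?case
    using assms by (simp add: eigenspace_def matrix_vector_mult_scaleR)
qed simp

theorem spectral_moments:
  fixes A :: "real^'n^'n" and e :: "real^'n"
  assumes sym: "transpose A = A"
  obtains L :: "real set" and w :: "real \<Rightarrow> real"
  where "finite L" "\<And>c. c \<in> L \<Longrightarrow> 0 < w c"
    "\<And>c. c \<in> L \<Longrightarrow> \<exists>v\<in>eigenspace A c. inner v e \<noteq> 0"
    "\<And>k. inner (matpow A k *v e) e = (\<Sum>c\<in>L. w c * c ^ k)"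
proof -
  obtain L x where L: "finite L" and x: "\<And>c. c \<in> L \<Longrightarrow> x c \<in> eigenspace A c"
    and nonzero: "\<And>c. c \<in> L \<Longrightarrow> x c \<noteq> 0" and e: "e = (\<Sum>c\<in>L. x c)"
    using eigenspace_decomposition[OF sym] by blast
  define w where "w c = inner (x c) (x c)" for c
  have component: "inner (x c) e = w c" if "c \<in> L" for c
  proof -
    have "inner (x c) e = (\<Sum>d\<in>L. if d = c then w c else 0)"
      unfolding e inner_sum_right w_def
      using eigenspaces_orthogonal[OF sym x x] that by (intro sum.cong) auto
    also have "\<dots> = w c"
      using L that by simp
    finally show ?thesis .
  qed
  have positive: "0 < w c" if "c \<in> L" for c
    unfolding w_def using nonzero[OF that] by simp
  show ?thesis
  proof (rule that[OF L positive])
    show "\<exists>v\<in>eigenspace A c. inner v e \<noteq> 0" if "c \<in> L" for c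
      using x[OF that] component[OF that] positive[OF that] by (intro bexI[of _ "x c"]) auto
    show "inner (matpow A k *v e) e = (\<Sum>c\<in>L. w c * c ^ k)" for k
    proof -
      have "matpow A k *v e = (\<Sum>c\<in>L. matpow A k *v x c)"
        unfolding e using linear_sum[OF matrix_vector_mul_linear[of "matpow A k"]] by (simp add: o_def)
      also have "\<dots> = (\<Sum>c\<in>L. c ^ k *\<^sub>R x c)"
        by (intro sum.cong refl) (simp add: matpow_eigenvector x)
      finally show ?thesis
        by (simp add: inner_sum_left component mult.commute)
    qed
  qed
qed

lemma kron_mult: "kron P Q ** kron R S = kron (P ** R) (Q ** S)"
proof -
  have "(\<Sum>r\<in>UNIV. P $ a $ fst r * Q $ b $ snd r * (R $ fst r $ c * S $ snd r $ d))
      = (\<Sum>i\<in>UNIV. P $ a $ i * R $ i $ c) * (\<Sum>j\<in>UNIV. Q $ b $ j * S $ j $ d)" for a b c d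
    unfolding sum_product sum.cartesian_product'[of _ UNIV UNIV, unfolded UNIV_Times_UNIV]
    by (simp add: algebra_simps)
  then show ?thesis
    unfolding kron_def matrix_matrix_mult_def by (simp add: vec_eq_iff)
qed

lemma kron_mat_1: "kron (mat 1) (mat 1) = mat 1"
  unfolding kron_def mat_def by (simp add: vec_eq_iff)

lemma adjK2_squared: "adjK2 ** adjK2 = mat 1"
  unfolding adjK2_def matrix_matrix_mult_def mat_def by (simp add: vec_eq_iff UNIV_bool)

lemma matpow_adjK2: "matpow adjK2 k = (if even k then mat 1 else adjK2)"
  by (induction k) (simp_all add: matpow_Suc adjK2_squared)

lemma matpow_kron: "matpow (kron P Q) k = kron (matpow P k) (matpow Q k)"
  by (induction k) (simp_all add: matpow_Suc kron_mult kron_mat_1)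

lemma matpow_bip_double_diag:
  "matpow (bip_double A) k $ (b, u) $ (b, u) = (if even k then matpow A k $ u $ u else 0)"
  unfolding bip_double_def matpow_kron matpow_adjK2 by (simp add: kron_def mat_def adjK2_def)

lemma transition_eq_series:
  "transition A t $ x $ y
    = (\<Sum>k. (\<i> * complex_of_real t) ^ k / of_nat (fact k) * complex_of_real (matpow A k $ x $ y))"
  unfolding transition_def matpow_def by simp

lemma transition_bip_double_diag:
  fixes A :: "real^'n^'n"
  assumes "finite L" and moments: "\<And>k. matpow A k $ u $ u = (\<Sum>c\<in>L. w c * c ^ k)"
  shows "transition (bip_double A) t $ (b, u) $ (b, u) = complex_of_real (\<Sum>c\<in>L. w c * cos (c * t))"
proof -
  have series_term: "(\<i> * complex_of_real t) ^ k / of_nat (fact k)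
        * complex_of_real (matpow (bip_double A) k $ (b, u) $ (b, u))
      = complex_of_real (\<Sum>c\<in>L. w c * (cos_coeff k * (c * t) ^ k))" for k
  proof (cases "even k")
    case True
    then obtain j where k: "k = 2 * j"
      by (auto elim: evenE)
    have "(\<i> * complex_of_real t) ^ k = complex_of_real ((-1) ^ j * t ^ k)"
      unfolding k by (simp add: power_mult power_mult_distrib power_minus[of "(complex_of_real t)\<^sup>2"])
    moreover have "(\<Sum>c\<in>L. w c * (cos_coeff k * (c * t) ^ k))
        = (-1) ^ j * t ^ k / fact k * (\<Sum>c\<in>L. w c * c ^ k)"
      unfolding cos_coeff_def using k
      by (simp add: sum_distrib_left power_mult_distrib algebra_simps sum_divide_distrib)
    ultimately show ?thesis
      using True by (simp add: matpow_bip_double_diag moments)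
  qed (simp add: matpow_bip_double_diag cos_coeff_def)
  have "(\<lambda>k. \<Sum>c\<in>L. w c * (cos_coeff k * (c * t) ^ k)) sums (\<Sum>c\<in>L. w c * cos (c * t))"
    by (intro sums_sum sums_mult) (use cos_converges[where x = "_ :: real"] in simp)
  then have "(\<lambda>k. (\<i> * complex_of_real t) ^ k / of_nat (fact k)
        * complex_of_real (matpow (bip_double A) k $ (b, u) $ (b, u)))
      sums complex_of_real (\<Sum>c\<in>L. w c * cos (c * t))"
    unfolding series_term by (rule sums_of_real)
  then show ?thesis
    unfolding transition_eq_series by (simp add: sums_iff)
qed

definition cos_primitive :: "real \<Rightarrow> real \<Rightarrow> real" where
  "cos_primitive a t = (if a = 0 then t else sin (a * t) / a)"

lemma cos_primitive_0 [simp]: "cos_primitive 0 t = t"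
  by (simp add: cos_primitive_def)

lemma cos_primitive_at_0 [simp]: "cos_primitive a 0 = 0"
  by (simp add: cos_primitive_def)

lemma abs_cos_primitive_le: "a \<noteq> 0 \<Longrightarrow> \<bar>cos_primitive a t\<bar> \<le> 1 / \<bar>a\<bar>"
  by (simp add: cos_primitive_def abs_divide divide_right_mono abs_sin_le_one)

lemma has_real_derivative_cos_primitive:
  "(cos_primitive a has_real_derivative cos (a * t)) (at t)"
proof (cases "a = 0")
  case False
  have "((\<lambda>t. sin (a * t) / a) has_real_derivative cos (a * t)) (at t)"
    using False by (auto intro!: derivative_eq_intros)
  then show ?thesis
    using False unfolding cos_primitive_def by simp
next
  case True
  then have "cos_primitive a = (\<lambda>t. t)"
    by (simp add: fun_eq_iff)
  then show ?thesis
    using True by (simp add: DERIV_ident)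
qed

definition damped_cos_primitive :: "real \<Rightarrow> real \<Rightarrow> real \<Rightarrow> real" where
  "damped_cos_primitive c m t =
    cos_primitive m t - cos_primitive (m - c) t / 2 - cos_primitive (m + c) t / 2"

lemma has_real_derivative_damped_cos_primitive:
  "(damped_cos_primitive c m has_real_derivative cos (m * t) * (1 - cos (c * t))) (at t)"
proof -
  have "cos ((m - c) * t) + cos ((m + c) * t) = 2 * cos (m * t) * cos (c * t)"
    by (simp add: left_diff_distrib distrib_right cos_diff cos_add)
  then have "cos (m * t) - cos ((m - c) * t) / 2 - cos ((m + c) * t) / 2
      = cos (m * t) * (1 - cos (c * t))"
    by (simp add: algebra_simps)
  moreover have "(damped_cos_primitive c m has_real_derivative
      cos (m * t) - cos ((m - c) * t) / 2 - cos ((m + c) * t) / 2) (at t)"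
    unfolding damped_cos_primitive_def[abs_def]
    by (intro DERIV_diff DERIV_cdivide has_real_derivative_cos_primitive)
  ultimately show ?thesis
    by simp
qed

lemma damped_cos_primitive_le:
  assumes "m \<noteq> 0" "0 < c"
  shows "\<exists>K. \<forall>t. damped_cos_primitive c m t \<le> K - (if \<bar>m\<bar> = c then t / 2 else 0)"
proof -
  have upper: "cos_primitive a t \<le> 1 / \<bar>a\<bar>" and lower: "- cos_primitive a t \<le> 1 / \<bar>a\<bar>"
    if "a \<noteq> 0" for a t
    using abs_cos_primitive_le[OF that, of t] by linarith+
  \<comment> \<open>for m = \<plusminus>c one summand is the unused junk value 1 / 0 = 0\<close>
  define K where "K = 1 / \<bar>m\<bar> + 1 / \<bar>m - c\<bar> / 2 + 1 / \<bar>m + c\<bar> / 2"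
  consider "m = c" | "m = - c" | "\<bar>m\<bar> \<noteq> c"
    by linarith
  then have "damped_cos_primitive c m t \<le> K - (if \<bar>m\<bar> = c then t / 2 else 0)" for t
  proof cases
    case 1
    then have "m + c \<noteq> 0" and "\<bar>m\<bar> = c"
      using assms by auto
    then show ?thesis
      using upper[OF assms(1), of t] lower[of "m + c" t] 1
      unfolding damped_cos_primitive_def K_def by simp
  next
    case 2
    then have "m - c \<noteq> 0" and "\<bar>m\<bar> = c"
      using assms by auto
    then show ?thesis
      using upper[OF assms(1), of t] lower[of "m - c" t] 2
      unfolding damped_cos_primitive_def K_def by simp
  next
    case 3
    then have "m - c \<noteq> 0" "m + c \<noteq> 0"
      using assms by auto
    then show ?thesis
      using upper[OF assms(1), of t] lower[of "m - c" t] lower[of "m + c" t] 3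
      unfolding damped_cos_primitive_def K_def by simp
  qed
  then show ?thesis
    by blast
qed

lemma damped_cos_sum_le:
  fixes L :: "real set" and w :: "real \<Rightarrow> real"
  assumes L: "finite L" "0 \<notin> L" and w: "\<And>m. m \<in> L \<Longrightarrow> 0 \<le> w m"
    and m0: "m0 \<in> L" "m0 \<noteq> 0"
  obtains K
  where "\<And>T. 0 \<le> T \<Longrightarrow> (\<Sum>m\<in>L. w m * damped_cos_primitive \<bar>m0\<bar> m T) \<le> K - T / 2 * w m0"
proof -
  define c where "c = \<bar>m0\<bar>"
  have "0 < c"
    unfolding c_def using m0(2) by simp
  have "\<forall>m\<in>L. \<exists>K. \<forall>T. damped_cos_primitive c m T \<le> K - (if \<bar>m\<bar> = c then T / 2 else 0)"
  proof
    fix m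
    assume "m \<in> L"
    then have "m \<noteq> 0"
      using L(2) by auto
    then show "\<exists>K. \<forall>T. damped_cos_primitive c m T \<le> K - (if \<bar>m\<bar> = c then T / 2 else 0)"
      using damped_cos_primitive_le[OF _ \<open>0 < c\<close>] by blast
  qed
  from bchoice[OF this] obtain K
    where K: "\<forall>m\<in>L. \<forall>T. damped_cos_primitive c m T \<le> K m - (if \<bar>m\<bar> = c then T / 2 else 0)"
    by blast
  have "(\<Sum>m\<in>L. w m * damped_cos_primitive c m T) \<le> (\<Sum>m\<in>L. w m * K m) - T / 2 * w m0"
    if "0 \<le> T" for T
  proof -
    have "(\<Sum>m\<in>L. w m * damped_cos_primitive c m T)
        \<le> (\<Sum>m\<in>L. w m * (K m - (if \<bar>m\<bar> = c then T / 2 else 0)))"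
      using K w by (intro sum_mono mult_left_mono) auto
    also have "\<dots> = (\<Sum>m\<in>L. w m * K m - T / 2 * (if \<bar>m\<bar> = c then w m else 0))"
      by (intro sum.cong) (auto simp: algebra_simps)
    also have "\<dots> = (\<Sum>m\<in>L. w m * K m) - T / 2 * (\<Sum>m\<in>L. if \<bar>m\<bar> = c then w m else 0)"
      by (simp add: sum_subtractf sum_distrib_left)
    also have "\<dots> \<le> (\<Sum>m\<in>L. w m * K m) - T / 2 * w m0"
    proof -
      have "w m0 \<le> (\<Sum>m\<in>L. if \<bar>m\<bar> = c then w m else 0)"
        using member_le_sum[of m0 L "\<lambda>m. if \<bar>m\<bar> = c then w m else 0"] L(1) m0(1) w
        unfolding c_def by simp
      then show ?thesis
        using that by (simp add: mult_left_mono)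
    qed
    finally show ?thesis .
  qed
  then show ?thesis
    using that unfolding c_def by blast
qed

lemma damped_cos_sum_nonneg:
  fixes L :: "real set" and w :: "real \<Rightarrow> real"
  assumes "\<And>t. 0 \<le> t \<Longrightarrow> 0 \<le> (\<Sum>m\<in>L. w m * cos (m * t))" and "0 \<le> T"
  shows "0 \<le> (\<Sum>m\<in>L. w m * damped_cos_primitive c m T)"
proof -
  define G where "G T = (\<Sum>m\<in>L. w m * damped_cos_primitive c m T)" for T
  have "G 0 \<le> G T"
  proof (rule DERIV_nonneg_imp_nondecreasing[OF assms(2)])
    fix t :: real
    assume "0 \<le> t" "t \<le> T"
    have "(G has_real_derivative (\<Sum>m\<in>L. w m * cos (m * t)) * (1 - cos (c * t))) (at t)"
      unfolding G_def sum_distrib_right mult.assoc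
      by (intro DERIV_sum DERIV_cmult has_real_derivative_damped_cos_primitive)
    moreover have "0 \<le> (\<Sum>m\<in>L. w m * cos (m * t)) * (1 - cos (c * t))"
      using assms(1)[OF \<open>0 \<le> t\<close>] by simp
    ultimately show "\<exists>y. (G has_real_derivative y) (at t) \<and> 0 \<le> y"
      by blast
  qed
  moreover have "G 0 = 0"
    by (simp add: G_def damped_cos_primitive_def)
  ultimately show ?thesis
    unfolding G_def by simp
qed

lemma pos_if_no_positive_root:
  fixes f :: "real \<Rightarrow> real"
  assumes "continuous_on {0..} f" "0 < f 0" "\<And>t. 0 < t \<Longrightarrow> f t \<noteq> 0" "0 \<le> t"
  shows "0 < f t"
proof (rule ccontr)
  assume "\<not> 0 < f t"
  then obtain s where "0 \<le> s" "s \<le> t" "f s = 0"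
    using IVT2'[of f t 0 0] assms(1,2,4) continuous_on_subset[OF assms(1), of "{0..t}"] by auto
  then show False
    using assms(2,3) by (cases "s = 0") auto
qed

theorem cos_sum_has_positive_root:
  fixes L :: "real set" and w :: "real \<Rightarrow> real"
  assumes L: "finite L" "0 \<notin> L" and w: "\<And>m. m \<in> L \<Longrightarrow> 0 \<le> w m"
  shows "\<exists>t>0. (\<Sum>m\<in>L. w m * cos (m * t)) = 0"
proof (rule ccontr)
  define f where "f t = (\<Sum>m\<in>L. w m * cos (m * t))" for t
  assume "\<not> ?thesis"
  then have no_root: "f t \<noteq> 0" if "0 < t" for t
    using that unfolding f_def by auto
  have "\<not> (\<forall>m\<in>L. w m = 0)"
  proof
    assume "\<forall>m\<in>L. w m = 0"
    then have "f 1 = 0"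
      unfolding f_def by simp
    then show False
      using no_root[of 1] by simp
  qed
  then obtain m0 where m0: "m0 \<in> L" "0 < w m0"
    using w by (force simp: order_le_less)
  then have "m0 \<noteq> 0"
    using L(2) by auto
  have "0 < f 0"
    unfolding f_def using L(1) m0 w by (simp add: sum_pos2)
  moreover have "continuous_on {0..} f"
    unfolding f_def by (intro continuous_intros)
  ultimately have f_pos: "0 < f t" if "0 \<le> t" for t
    using pos_if_no_positive_root no_root that by blast
  define G where "G T = (\<Sum>m\<in>L. w m * damped_cos_primitive \<bar>m0\<bar> m T)" for T
  have G_nonneg: "0 \<le> G T" if "0 \<le> T" for T
    unfolding G_def using f_pos that by (intro damped_cos_sum_nonneg) (auto simp: f_def less_imp_le)
  obtain K where K: "\<And>T. 0 \<le> T \<Longrightarrow> G T \<le> K - T / 2 * w m0"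
    using damped_cos_sum_le[of L w m0, OF L w m0(1) \<open>m0 \<noteq> 0\<close>] unfolding G_def by blast
  define T where "T = 2 * (\<bar>K\<bar> + 1) / w m0"
  have "0 \<le> T" and "T / 2 * w m0 = \<bar>K\<bar> + 1"
    unfolding T_def using m0(2) by auto
  then show False
    using G_nonneg[of T] K[of T] abs_ge_self[of K] by linarith
qed

lemma diag_eq_inner_basis_vec: "(M::real^'n^'n) $ u $ u = inner (M *v basis_vec u) (basis_vec u)"
  unfolding inner_vec_def matrix_vector_mult_def basis_vec_def
  by (simp add: if_distrib cong: if_cong)

lemma orthogonal_eigenspace_if_notin_eigsupp:
  assumes "c \<notin> eigsupp A u" and "v \<in> eigenspace A c"
  shows "inner v (basis_vec u) = 0"
proof -
  have S: "convex (eigenspace A c)" "closed (eigenspace A c)"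
    using subspace_eigenspace by (auto intro: subspace_imp_convex closed_subspace)
  have "closest_point (eigenspace A c) (basis_vec u) = 0"
    using assms(1) by (simp add: eigsupp_def eigenproj_def)
  moreover have "- v \<in> eigenspace A c"
    using assms(2) subspace_eigenspace by (rule subspace_neg[rotated])
  ultimately have "inner (basis_vec u) v \<le> 0" "inner (basis_vec u) (- v) \<le> 0"
    using closest_point_dot[OF S, of v "basis_vec u"] closest_point_dot[OF S, of "- v" "basis_vec u"]
      assms(2) by auto
  then show ?thesis
    by (simp add: inner_commute)
qed

lemma zero_notin_eigsupp_if_invertible:
  fixes A :: "real^'n^'n"
  assumes "invertible A"
  shows "0 \<notin> eigsupp A u"
proof -
  have "eigenspace A 0 = {0}"
    using assms matrix_left_invertible_ker
    by (auto simp: eigenspace_def invertible_def)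
  moreover have "closest_point {0} (basis_vec u) \<in> {0}"
    by (rule closest_point_in_set) auto
  ultimately show ?thesis
    by (simp add: eigsupp_def eigenproj_def)
qed

lemma not_sedentary_if_transition_vanishes:
  assumes "0 < t" and "transition A t $ v $ v = 0"
  shows "\<not> sedentary A v"
proof -
  have "(INF s\<in>{0<..}. cmod (transition A s $ v $ v)) \<le> cmod (transition A t $ v $ v)"
    using assms(1) by (intro cINF_lower bdd_belowI[of _ 0]) auto
  then show ?thesis
    using assms(2) by (simp add: sedentary_def)
qed

theorem bip_double_not_sedentary:
  fixes A :: "real^'n^'n"
  assumes sym: "transpose A = A" and "0 \<notin> eigsupp A u"
  shows "\<not> sedentary (bip_double A) (b, u)"
proof -
  obtain L w where L: "finite L" and w: "\<And>c. c \<in> L \<Longrightarrow> 0 < w c"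
    and supp: "\<And>c. c \<in> L \<Longrightarrow> \<exists>v\<in>eigenspace A c. inner v (basis_vec u) \<noteq> 0"
    and moments: "\<And>k. inner (matpow A k *v basis_vec u) (basis_vec u) = (\<Sum>c\<in>L. w c * c ^ k)"
    using spectral_moments[OF sym, where e = "basis_vec u"] by blast
  have "0 \<notin> L"
    using supp orthogonal_eigenspace_if_notin_eigsupp[OF assms(2)] by blast
  then obtain t where "0 < t" "(\<Sum>c\<in>L. w c * cos (c * t)) = 0"
    using cos_sum_has_positive_root[OF L] w by (meson less_imp_le)
  moreover have "matpow A k $ u $ u = (\<Sum>c\<in>L. w c * c ^ k)" for k
    using moments[of k] diag_eq_inner_basis_vec[of "matpow A k" u] by simp
  then have "transition (bip_double A) t $ (b, u) $ (b, u) = complex_of_real (\<Sum>c\<in>L. w c * cos (c * t))"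
    by (rule transition_bip_double_diag[OF L])
  ultimately show ?thesis
    using not_sedentary_if_transition_vanishes by simp
qed

theorem theorem30:
  fixes A :: "real^'n^'n" and u :: 'n
  assumes "weighted_graph A"
    and "connected_graph A"
    and "\<not> bipartite_graph A"
  shows "(0 \<notin> eigsupp A u \<longrightarrow>
            \<not> sedentary (bip_double A) (False, u) \<and> \<not> sedentary (bip_double A) (True, u))
       \<and> (invertible A \<longrightarrow> (\<forall>v. \<not> sedentary (bip_double A) v))"
proof -
  have sym: "transpose A = A"
    using assms(1) by (simp add: weighted_graph_def)
  have "\<not> sedentary (bip_double A) v" if "invertible A" for v
    using bip_double_not_sedentary[OF sym zero_notin_eigsupp_if_invertible[OF that]]
    by (cases v) simp
  then show ?thesis
    using bip_double_not_sedentary[OF sym] by blast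
qed

end
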